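(* Let $N\ge4$ be an even integer, $\tau\in\mathbf C$ with $\operatorname{Im}\tau>0$, and let $E_{\Theta_\tau}\subset\mathbf P^{N-1}$ be the image of $\mathbf{C}/(\mathbf Z+\mathbf Z\tau)$ under $z\mapsto(\theta^{(N)}_0(z,\tau):\dots:\theta^{(N)}_{N-1}(z,\tau))$. Let $X_0,\dots,X_{N-1}$ be the coordinates of $\mathbf P^{N-1}$ (indices in $\mathbf Z/N\mathbf Z$), let $V=H^0(\mathbf P^{N-1},\mathcal I_{E_{\Theta_\tau}}(2))$ be the space of quadratic forms vanishing on $E_{\Theta_\tau}$, and let $V_k=V\cap\langle X_iX_j\mid i+j\equiv k\bmod N\rangle$. Put $a_i=\theta^{(N)}_i(0,\tau)$. Then: (1) For all $k=0,\dots,\frac N2-1$, $V_{2k}$ is isomorphic to $V_0$ and $V_{2k+1}$ is isomorphic to $V_1$, by the map induced by $X_iX_j\mapsto X_{i+k}X_{j+k}$ (indices in $\mathbf Z/N\mathbf Z$). (2) The quadratic forms $$a_j^2X_0^2+a_{\frac N2+j}^2X_{\frac N2}^2-a_0^2X_jX_{N-j}-a_{\frac N2}^2X_{\frac N2+j}X_{\frac N2-j},\qquad j=1,\dots,\tfrac N2-1,$$ form a basis of $V_0$, and the quadratic forms $$a_ja_{j+1}X_0X_1+a_{\frac N2+j}a_{\frac N2+j+1}X_{\frac N2}X_{\frac N2+1}-a_0a_1X_{j+1}X_{N-j}-a_{\frac N2}a_{\frac N2+1}X_{\frac N2+j+1}X_{\frac N2-j},\qquad j=1,\dots,\tfrac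 N2-2,$$ form a basis of $V_1$.
   Context: With $\mathbf e(x)=e^{2\pi i x}$, for an integer $k$, $$\theta^{(N)}_k(z,\tau)=\sum_{n\in\mathbf Z}\mathbf e\Bigl(\tfrac12N\bigl(n-\tfrac kN+\tfrac12\bigr)^2\tau+N\bigl(n-\tfrac kN+\tfrac12\bigr)\bigl(z+\tfrac12\bigr)\Bigr),$$ which depends only on $k\bmod N$. The map $z\mapsto(\theta_0^{(N)}(z,\tau):\dots:\theta^{(N)}_{N-1}(z,\tau))$ embeds the elliptic curve $\mathbf C/(\mathbf Z+\mathbf Z\tau)$ as a curve of degree $N$ in $\mathbf P^{N-1}$. *)

theory Defs
  imports "HOL-Analysis.Analysis" "HOL-Library.Poly_Mapping"
begin

text \<open>
  All indices are integers: an index in \<open>\<int>/N\<int>\<close> is given by any integer representing it, and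
  its normal form is the representative in \<open>{0..<N}\<close>.
\<close>

definition e_exp :: "complex \<Rightarrow> complex" where
  "e_exp x = exp (2 * of_real pi * \<i> * x)"

definition theta :: "int \<Rightarrow> int \<Rightarrow> complex \<Rightarrow> complex \<Rightarrow> complex" where
  "theta N k z \<tau> = (\<Sum>\<^sub>\<infinity>n\<in>(UNIV::int set).
     e_exp (1/2 * of_int N * (of_int n - of_int k / of_int N + 1/2)\<^sup>2 * \<tau>
            + of_int N * (of_int n - of_int k / of_int N + 1/2) * (z + 1/2)))"


subsection \<open>Projective space and the curve\<close>

text \<open>
  A vector of \<open>\<complex>\<^sup>N\<close> is a function vanishing outside \<open>{0..<N}\<close>; the point of projective space
  given by a vector \<open>v \<noteq> 0\<close> is the set of its nonzero multiples.
\<close>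

definition proj_point :: "(int \<Rightarrow> complex) \<Rightarrow> (int \<Rightarrow> complex) set" where
  "proj_point v = {\<lambda>i. c * v i | c. c \<noteq> 0}"

definition theta_vec :: "int \<Rightarrow> complex \<Rightarrow> complex \<Rightarrow> int \<Rightarrow> complex" where
  "theta_vec N \<tau> z = (\<lambda>i. if i \<in> {0..<N} then theta N i z \<tau> else 0)"

text \<open>
  The map factors through \<open>\<complex>/(\<int> + \<int>\<tau>)\<close>, so its image is the image of \<open>\<complex>\<close>.
\<close>

definition theta_curve :: "int \<Rightarrow> complex \<Rightarrow> (int \<Rightarrow> complex) set set" where
  "theta_curve N \<tau> = range (\<lambda>z. proj_point (theta_vec N \<tau> z))"


subsection \<open>Polynomials and quadratic forms\<close>

type_synonym cpoly = "(int \<Rightarrow>\<^sub>0 nat) \<Rightarrow>\<^sub>0 complex"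

definition poly_scale :: "complex \<Rightarrow> cpoly \<Rightarrow> cpoly" where
  "poly_scale c p = Poly_Mapping.map ((*) c) p"

lemma lookup_poly_scale [simp]:
  "Poly_Mapping.lookup (poly_scale c p) m = c * Poly_Mapping.lookup p m"
  by (simp add: poly_scale_def Poly_Mapping.map.rep_eq when_def)

global_interpretation cpoly: vector_space poly_scale
  by unfold_locales (auto intro!: poly_mapping_eqI simp: lookup_add algebra_simps)

definition coord :: "int \<Rightarrow> int \<Rightarrow> cpoly" where
  "coord N i = Poly_Mapping.single (Poly_Mapping.single (i mod N) 1) 1"

definition eval_poly :: "cpoly \<Rightarrow> (int \<Rightarrow> complex) \<Rightarrow> complex" where
  "eval_poly p v =
     (\<Sum>m\<in>Poly_Mapping.keys p.
        Poly_Mapping.lookup p m * (\<Prod>i\<in>Poly_Mapping.keys m. v i ^ Poly_Mapping.lookup m i))"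

definition quadratic_forms :: "int \<Rightarrow> cpoly set" where
  "quadratic_forms N =
     {p. \<forall>m\<in>Poly_Mapping.keys p.
           Poly_Mapping.keys m \<subseteq> {0..<N} \<and> (\<Sum>i\<in>Poly_Mapping.keys m. Poly_Mapping.lookup m i) = 2}"

definition vanishing_quadrics :: "int \<Rightarrow> (int \<Rightarrow> complex) set set \<Rightarrow> cpoly set" where
  "vanishing_quadrics N E = {p \<in> quadratic_forms N. \<forall>P\<in>E. \<forall>v\<in>P. eval_poly p v = 0}"

definition graded_quadrics :: "int \<Rightarrow> complex \<Rightarrow> int \<Rightarrow> cpoly set" where
  "graded_quadrics N \<tau> k =
     vanishing_quadrics N (theta_curve N \<tau>) \<inter>
     cpoly.span {coord N i * coord N j | i j. (i + j) mod N = k mod N}"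

definition basis_family :: "('i \<Rightarrow> cpoly) \<Rightarrow> 'i set \<Rightarrow> cpoly set \<Rightarrow> bool" where
  "basis_family f I W \<longleftrightarrow> inj_on f I \<and> cpoly.independent (f ` I) \<and> cpoly.span (f ` I) = W"

end

theory Submission
  imports Defs
begin

text \<open>
  For fixed \<open>k\<close> the products \<open>\<theta>\<^sub>i \<theta>\<^sub>j\<close> with \<open>i + j = k\<close> all lie in a space spanned by two functions
  of \<open>z\<close>, with coefficients \<open>\<beta> (i - j)\<close> and \<open>\<beta> (i - j + N)\<close> that are values of a theta constant: in
  the double series substitute \<open>u = n + m\<close>, \<open>v = n - m\<close> and split by the common parity of \<open>u\<close> and \<open>v\<close>.
  The stated quadrics are the resulting linear relations, and they form a basis because
  \<open>(\<beta> \<epsilon>)\<^sup>2 \<noteq> (\<beta> (\<epsilon> + N))\<^sup>2\<close> for \<open>\<epsilon> = 0, 1\<close>. Up to nonzero factors, \<open>\<beta> \<epsilon> \<plusminus> \<beta> (\<epsilon> + N)\<close> are the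
  values \<open>\<Sum>n. (\<plusminus>1)\<^sup>n e(t (n - x)\<^sup>2 / 2)\<close> at \<open>t = N \<tau> / 2\<close>, \<open>x = \<epsilon> / N\<close>. Their product is the product of
  the alternating series for \<open>(2 t, x)\<close> and \<open>(2 t, 0)\<close>, so by repeated doubling of \<open>t\<close> it suffices
  that the alternating series does not vanish when \<open>Im t\<close> is large. The isomorphisms
  \<open>V\<^sub>r \<cong> V\<^sub>r\<^sub>+\<^sub>2\<^sub>k\<close> come from translation by the torsion point \<open>k \<tau> / N\<close>, which rotates the coordinates.
\<close>


subsection \<open>Theta functions with real characteristics\<close>

lemma e_exp_add: "e_exp (x + y) = e_exp x * e_exp y"
  by (simp add: e_exp_def exp_add algebra_simps)

lemma e_exp_nonzero [simp]: "e_exp x \<noteq> 0"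
  by (simp add: e_exp_def)

lemma e_exp_of_int [simp]: "e_exp (of_int n) = 1"
proof -
  have "2 * of_real pi * \<i> * of_int n = \<i> * (of_int n * (of_real pi * 2))" by (simp only: ac_simps)
  then show ?thesis by (simp only: e_exp_def exp_2pi_1_int)
qed

lemma e_exp_half: "e_exp (1 / 2) = -1"
  by (simp add: e_exp_def)

lemma e_exp_of_int_half: "e_exp (of_int n / 2) = (if even n then 1 else -1)"
proof (cases "even n")
  case True
  then obtain m where "n = 2 * m" by blast
  then show ?thesis by simp
next
  case False
  then obtain m where "n = 2 * m + 1" by (blast elim: oddE)
  then have "e_exp (of_int n / 2) = e_exp (of_int m + 1 / 2)"
    by (simp add: field_simps)
  with False show ?thesis by (simp add: e_exp_add e_exp_half)
qed

lemma norm_e_exp: "norm (e_exp x) = exp (- 2 * pi * Im x)"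
  by (simp add: e_exp_def)

section \<open>Double series and a geometric majorant on the integers\<close>

lemma has_sum_times:
  fixes f :: "'a \<Rightarrow> complex" and g :: "'b \<Rightarrow> complex"
  assumes "(\<lambda>x. norm (f x)) summable_on A" "(\<lambda>x. norm (g x)) summable_on B"
  shows "((\<lambda>(x, y). f x * g y) has_sum (infsum f A * infsum g B)) (A \<times> B)"
proof (rule has_sum_SigmaI)
  show "((\<lambda>y. case (x, y) of (x, y) \<Rightarrow> f x * g y) has_sum (f x * infsum g B)) B" if "x \<in> A" for x
    using assms by (auto intro!: has_sum_cmult_right has_sum_infsum abs_summable_summable)
  show "((\<lambda>x. f x * infsum g B) has_sum (infsum f A * infsum g B)) A"
    using assms by (auto intro!: has_sum_cmult_left has_sum_infsum abs_summable_summable)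
  have "(\<lambda>p. norm (case p of (x, y) \<Rightarrow> f x * g y)) summable_on A \<times> B"
  proof (rule summable_on_SigmaI)
    show "((\<lambda>y. norm (case (x, y) of (x, y) \<Rightarrow> f x * g y)) has_sum
           (norm (f x) * (\<Sum>\<^sub>\<infinity>y\<in>B. norm (g y)))) B" if "x \<in> A" for x
      using assms by (auto simp: norm_mult intro!: has_sum_cmult_right)
    show "(\<lambda>x. norm (f x) * (\<Sum>\<^sub>\<infinity>y\<in>B. norm (g y))) summable_on A"
      using assms by (intro summable_on_cmult_left) auto
  qed auto
  then show "(\<lambda>(x, y). f x * g y) summable_on A \<times> B"
    by (rule abs_summable_summable)
qed

lemma has_sum_geometric_int:
  fixes r :: real
  assumes "0 \<le> r" "r < 1"
  shows "((\<lambda>n::int. r ^ nat \<bar>n\<bar>) has_sum (2 * r / (1 - r))) (- {0})"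
proof -
  have *: "((\<lambda>n. r * r ^ n) has_sum (r * (1 / (1 - r)))) UNIV"
    using assms by (intro has_sum_cmult_right sums_nonneg_imp_has_sum geometric_sums) auto
  have "((\<lambda>n::int. r ^ nat \<bar>n\<bar>) has_sum (r / (1 - r))) {0<..}"
    using * by (subst has_sum_reindex_bij_witness[of "{0<..}" "\<lambda>n. int n + 1" "\<lambda>n. nat (n - 1)" UNIV
          "\<lambda>n. r * r ^ n" _ _ "r * (1 / (1 - r))"])
      (auto simp flip: power_Suc simp: nat_diff_distrib Suc_nat_eq_nat_zadd1)
  moreover from this have "((\<lambda>n::int. r ^ nat \<bar>n\<bar>) has_sum (r / (1 - r))) {..<0}"
    by (subst has_sum_reindex_bij_witness[of "{..<0}" uminus uminus "{0<..}"
          "\<lambda>n. r ^ nat \<bar>n\<bar>" _ _ "r / (1 - r)"]) auto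
  ultimately have "((\<lambda>n::int. r ^ nat \<bar>n\<bar>) has_sum (r / (1 - r) + r / (1 - r))) ({0<..} \<union> {..<0})"
    by (rule has_sum_Un_disjoint) auto
  moreover have "{0<..} \<union> {..<0} = - {0::int}" by auto
  ultimately show ?thesis by simp
qed

text \<open>The characteristic \<open>x\<close> is real, so the modulus of a term is the exponential
  of a real quadratic polynomial in \<open>n\<close>.\<close>

definition theta_term :: "complex \<Rightarrow> real \<Rightarrow> complex \<Rightarrow> int \<Rightarrow> complex" where
  "theta_term \<tau> x z n =
     e_exp (\<tau> * (of_int n - of_real x)\<^sup>2 / 2 + (of_int n - of_real x) * z)"

text \<open>\<open>theta_char \<tau> x z\<close> is the theta function with characteristics \<open>(- x, 0)\<close>.\<close>

definition theta_char :: "complex \<Rightarrow> real \<Rightarrow> complex \<Rightarrow> complex" where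
  "theta_char \<tau> x z = infsum (theta_term \<tau> x z) UNIV"

lemma norm_theta_term:
  "norm (theta_term \<tau> x z n) = exp (- pi * Im \<tau> * (n - x)\<^sup>2 - 2 * pi * (n - x) * Im z)"
proof -
  have "(complex_of_int n - of_real x)\<^sup>2 = of_real ((of_int n - x)\<^sup>2)" by simp
  then show ?thesis
    unfolding theta_term_def norm_e_exp
    by (simp del: of_real_power of_real_diff add: algebra_simps)
qed

text \<open>Completing the square bounds the quadratic exponent by a linear one, so a geometric
  series in \<open>\<bar>n\<bar>\<close> dominates.\<close>

lemma theta_term_abs_summable:
  assumes "Im \<tau> > 0"
  shows "(\<lambda>n. norm (theta_term \<tau> x z n)) summable_on UNIV"
proof -
  \<comment> \<open>The summand \<open>1\<close> in \<open>\<beta>\<close> leaves the decay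
    \<open>exp (- \<bar>n - x\<bar>)\<close> once the term linear in \<open>Im z\<close> is
    absorbed.\<close>
  define \<alpha> \<beta> where "\<alpha> = pi * Im \<tau>" and "\<beta> = 2 * pi * \<bar>Im z\<bar> + 1"
  have \<alpha>: "\<alpha> > 0" using assms by (simp add: \<alpha>_def)
  \<comment> \<open>The quotient is the constant left over from completing the square;
    \<open>\<bar>x\<bar>\<close> pays for replacing \<open>\<bar>n - x\<bar>\<close> by
    \<open>\<bar>n\<bar>\<close>.\<close>
  define C where "C = \<beta>\<^sup>2 / (4 * \<alpha>) + \<bar>x\<bar>"
  have "norm (theta_term \<tau> x z n) \<le> exp C * exp (- 1) ^ nat \<bar>n\<bar>" for n
  proof -
    have "0 \<le> (\<alpha> * \<bar>n - x\<bar> - \<beta> / 2)\<^sup>2 / \<alpha>" using \<alpha> by simp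
    also have "\<dots> = \<alpha> * (n - x)\<^sup>2 - \<beta> * \<bar>n - x\<bar> + \<beta>\<^sup>2 / (4 * \<alpha>)"
      using \<alpha> by (simp add: field_simps power2_diff) (simp add: power2_eq_square algebra_simps)
    finally have *: "- \<alpha> * (n - x)\<^sup>2 \<le> \<beta>\<^sup>2 / (4 * \<alpha>) - \<beta> * \<bar>n - x\<bar>" by simp
    have "- (2 * pi * (n - x) * Im z) \<le> \<bar>2 * pi * (n - x) * Im z\<bar>" by (rule abs_ge_minus_self)
    also have "\<dots> = (\<beta> - 1) * \<bar>n - x\<bar>" by (simp add: abs_mult \<beta>_def)
    finally have "- \<alpha> * (n - x)\<^sup>2 - 2 * pi * (n - x) * Im z \<le> \<beta>\<^sup>2 / (4 * \<alpha>) - \<bar>n - x\<bar>"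
      using * by (simp add: algebra_simps)
    also have "\<dots> \<le> C + - of_int \<bar>n\<bar>" unfolding C_def by linarith
    finally have "norm (theta_term \<tau> x z n) \<le> exp (C + - of_int \<bar>n\<bar>)"
      by (simp add: norm_theta_term \<alpha>_def)
    also have "\<dots> = exp C * exp (- 1) ^ nat \<bar>n\<bar>"
      unfolding exp_add by (simp flip: exp_of_nat_mult)
    finally show ?thesis .
  qed
  moreover have "(\<lambda>n::int. exp C * exp (- 1) ^ nat \<bar>n\<bar>) summable_on UNIV"
  proof -
    have "(\<lambda>n::int. exp (- 1) ^ nat \<bar>n\<bar> :: real) summable_on insert 0 (- {0})"
      using has_sum_geometric_int[of "exp (- 1)"]
      by (subst summable_on_insert_iff) (auto simp: summable_on_def)
    moreover have "insert 0 (- {0}) = (UNIV :: int set)" by auto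
    ultimately show ?thesis by (intro summable_on_cmult_right) simp
  qed
  ultimately show ?thesis
    using Infinite_Sum.abs_summable_on_comparison_test'[of "\<lambda>n. exp C * exp (- 1) ^ nat \<bar>n\<bar>" UNIV "theta_term \<tau> x z"]
    by blast
qed

lemma theta_char_has_sum:
  assumes "Im \<tau> > 0"
  shows "(theta_term \<tau> x z has_sum theta_char \<tau> x z) UNIV"
  unfolding theta_char_def
  by (rule has_sum_infsum[OF abs_summable_summable[OF theta_term_abs_summable[OF assms]]])

section \<open>Transformation laws in the characteristic and in \<open>z\<close>\<close>

lemma theta_char_periodic: "theta_char \<tau> (x + of_int m) z = theta_char \<tau> x z"
  unfolding theta_char_def
  by (rule infsum_reindex_bij_witness[of _ "\<lambda>n. n + m" "\<lambda>n. n - m"])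
     (auto simp: theta_term_def algebra_simps)

lemma theta_char_minus: "theta_char \<tau> (- x) (- z) = theta_char \<tau> x z"
  unfolding theta_char_def
  by (rule infsum_reindex_bij_witness[of _ uminus uminus])
     (auto simp: theta_term_def power2_eq_square algebra_simps)

lemma theta_char_add_int:
  "theta_char \<tau> x (z + of_int m) = e_exp (- of_int m * of_real x) * theta_char \<tau> x z"
proof -
  have "theta_term \<tau> x (z + of_int m) n = e_exp (- of_int m * of_real x) * theta_term \<tau> x z n" for n
  proof -
    have "theta_term \<tau> x (z + of_int m) n =
        e_exp (- of_int m * of_real x) * theta_term \<tau> x z n * e_exp (of_int (n * m))"
      unfolding theta_term_def by (simp flip: e_exp_add add: algebra_simps del: e_exp_of_int)
    then show ?thesis unfolding e_exp_of_int by simp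
  qed
  then show ?thesis unfolding theta_char_def by (subst infsum_cmult_right'[symmetric]) (rule infsum_cong)
qed

text \<open>Expanding the square trades a shift of the characteristic for a translation of
  \<open>z\<close>. The factor in front does not involve \<open>x\<close>, so it will be common to
  all coordinates of the curve.\<close>

lemma theta_char_shift:
  "theta_char \<tau> (x + y) z =
     e_exp (\<tau> * (of_real y)\<^sup>2 / 2 - of_real y * z) * theta_char \<tau> x (z - of_real y * \<tau>)"
proof -
  have "theta_term \<tau> (x + y) z n =
    e_exp (\<tau> * (of_real y)\<^sup>2 / 2 - of_real y * z) * theta_term \<tau> x (z - of_real y * \<tau>) n" for n
    unfolding theta_term_def e_exp_add[symmetric]
    by (rule arg_cong[where f = e_exp]) (simp add: power2_eq_square field_simps)
  then show ?thesis unfolding theta_char_def by (subst infsum_cmult_right'[symmetric]) (rule infsum_cong)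
qed

text \<open>This is the value of the odd theta function at its zero: moving both halves by
  \<open>1\<close> gives the factor \<open>e_exp (1 / 2) = -1\<close>, and the symmetry
  \<open>theta_char_minus\<close> leads back to the same value.\<close>

lemma theta_char_half_half [simp]: "theta_char \<tau> (1 / 2) (1 / 2) = 0"
proof -
  have "theta_char \<tau> (1 / 2) (1 / 2) = theta_char \<tau> (- (1 / 2) + of_int 1) (- (1 / 2) + of_int 1)"
    by simp
  also have "\<dots> = theta_char \<tau> (- (1 / 2)) (- (1 / 2) + of_int 1)"
    by (rule theta_char_periodic)
  also have "\<dots> = - theta_char \<tau> (1 / 2) (1 / 2)"
    by (subst theta_char_add_int) (simp add: e_exp_half theta_char_minus)
  finally show ?thesis by simp
qed

section \<open>Product and splitting formulas\<close>

lemma theta_char_mult: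
  assumes "Im \<tau> > 0"
  shows "theta_char \<tau> x z * theta_char \<tau> y w =
    theta_char (2 * \<tau>) ((x + y) / 2) (z + w) * theta_char (2 * \<tau>) ((x - y) / 2) (z - w) +
    theta_char (2 * \<tau>) ((x + y - 1) / 2) (z + w) * theta_char (2 * \<tau>) ((x - y - 1) / 2) (z - w)"
proof -
  define F where "F = (\<lambda>(n, m). theta_term \<tau> x z n * theta_term \<tau> y w m)"
  \<comment> \<open>The pair \<open>(n, m) = h c (k, l)\<close> has \<open>n + m = 2 * k + c\<close>
    and \<open>n - m = 2 * l + c\<close>, so \<open>c = 0, 1\<close> give the two parity classes.
    The exponents match by the parallelogram identity.\<close>
  define h where "h c = (\<lambda>(k, l). (k + l + c, k - l))" for c :: int
  have sum: "(F has_sum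
      (theta_char (2 * \<tau>) ((x + y - c) / 2) (z + w) * theta_char (2 * \<tau>) ((x - y - c) / 2) (z - w)))
      (h c ` UNIV)" for c :: int
  proof -
    have "theta_term (2 * \<tau>) ((x + y - c) / 2) (z + w) k * theta_term (2 * \<tau>) ((x - y - c) / 2) (z - w) l
        = F (h c (k, l))" for k l
      unfolding theta_term_def F_def h_def prod.case e_exp_add[symmetric]
      by (rule arg_cong[where f = e_exp]) (simp add: power2_eq_square field_simps)
    then have *: "F \<circ> h c = (\<lambda>(k, l). theta_term (2 * \<tau>) ((x + y - c) / 2) (z + w) k
        * theta_term (2 * \<tau>) ((x - y - c) / 2) (z - w) l)"
      by auto
    have "inj (h c)" by (auto simp: inj_def h_def)
    then show ?thesis
      using has_sum_times[OF theta_term_abs_summable theta_term_abs_summable, of "2 * \<tau>" "2 * \<tau>"] assms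
      by (simp add: has_sum_reindex * theta_char_def)
  qed
  have parity: "h 0 ` UNIV = {(n, m). even (n + m)}" "h 1 ` UNIV = {(n, m). odd (n + m)}"
  proof -
    have "(n, m) \<in> h 0 ` UNIV" if nm: "even (n + m)" for n m
    proof -
      obtain k where "n + m = 2 * k" using nm by (blast elim: evenE)
      then have "(n, m) = h 0 (k, k - m)" by (simp add: h_def)
      then show ?thesis by blast
    qed
    moreover have "(n, m) \<in> h 1 ` UNIV" if nm: "odd (n + m)" for n m
    proof -
      obtain k where "n + m = 2 * k + 1" using nm by (blast elim: oddE)
      then have "(n, m) = h 1 (k, k - m)" by (simp add: h_def)
      then show ?thesis by blast
    qed
    ultimately show "h 0 ` UNIV = {(n, m). even (n + m)}" "h 1 ` UNIV = {(n, m). odd (n + m)}"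
      by (auto simp: h_def)
  qed
  have "{(n, m). even (n + m)} \<union> {(n, m). odd (n + m)} = (UNIV :: (int \<times> int) set)" by auto
  then have "(F has_sum
      (theta_char (2 * \<tau>) ((x + y) / 2) (z + w) * theta_char (2 * \<tau>) ((x - y) / 2) (z - w) +
       theta_char (2 * \<tau>) ((x + y - 1) / 2) (z + w) * theta_char (2 * \<tau>) ((x - y - 1) / 2) (z - w))) UNIV"
    using has_sum_Un_disjoint[OF sum[of 0] sum[of 1]] by (auto simp: parity)
  moreover have "(F has_sum (theta_char \<tau> x z * theta_char \<tau> y w)) UNIV"
    using has_sum_times[OF theta_term_abs_summable theta_term_abs_summable, OF assms assms]
    by (simp add: F_def theta_char_def)
  ultimately show ?thesis by (rule has_sum_unique[symmetric])
qed

text \<open>The series is split into even and odd \<open>n\<close>. Read backwards, this turns sums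
  and differences of two theta constants into single theta values, whose vanishing can be
  decided.\<close>

lemma theta_char_split:
  assumes "Im \<tau> > 0"
  shows "theta_char \<tau> x z =
    theta_char (4 * \<tau>) (x / 2) (2 * z) + theta_char (4 * \<tau>) ((x - 1) / 2) (2 * z)"
proof -
  have sum: "(theta_term \<tau> x z has_sum theta_char (4 * \<tau>) ((x - c) / 2) (2 * z)) ((\<lambda>n. 2 * n + c) ` UNIV)"
    for c :: int
  proof -
    have "theta_term (4 * \<tau>) ((x - c) / 2) (2 * z) n = theta_term \<tau> x z (2 * n + c)" for n
      unfolding theta_term_def
      by (rule arg_cong[where f = e_exp]) (simp add: power2_eq_square field_simps)
    then have "theta_term (4 * \<tau>) ((x - c) / 2) (2 * z) = theta_term \<tau> x z \<circ> (\<lambda>n. 2 * n + c)"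
      by auto
    then show ?thesis
      using theta_char_has_sum[of "4 * \<tau>" "(x - c) / 2" "2 * z"] assms
      by (subst has_sum_reindex) (auto simp: inj_def)
  qed
  have "range (\<lambda>n. 2 * n + 0) \<inter> range (\<lambda>n. 2 * n + 1) = ({} :: int set)"
    by auto presburger
  moreover have "range (\<lambda>n. 2 * n + 0) \<union> range (\<lambda>n. 2 * n + 1) = (UNIV :: int set)"
    by (auto simp: image_iff) presburger
  ultimately have "(theta_term \<tau> x z has_sum
      (theta_char (4 * \<tau>) (x / 2) (2 * z) + theta_char (4 * \<tau>) ((x - 1) / 2) (2 * z))) UNIV"
    using has_sum_Un_disjoint[OF sum[of 0] sum[of 1]] by simp
  with theta_char_has_sum[OF assms] show ?thesis by (rule has_sum_unique)
qed

section \<open>Non-vanishing of theta constants\<close>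

lemma theta_char_half_nonzero_if_large:
  assumes "Im \<tau> > 0" "\<bar>x\<bar> < 1 / 2" and small: "exp (- pi * Im \<tau> * (1 - 2 * \<bar>x\<bar>)) < 1 / 3"
  shows "theta_char \<tau> x (1 / 2) \<noteq> 0"
proof
  assume zero: "theta_char \<tau> x (1 / 2) = 0"
  \<comment> \<open>The term at \<open>0\<close> outweighs all others together: the term at
    \<open>n\<close> is at most \<open>r ^ nat \<bar>n\<bar>\<close> times as large, and
    \<open>2 * r / (1 - r) < 1\<close> because \<open>r < 1 / 3\<close>.\<close>
  define r where "r = exp (- pi * Im \<tau> * (1 - 2 * \<bar>x\<bar>))"
  define t where "t = theta_term \<tau> x (1 / 2)"
  have norm_t: "norm (t n) = exp (- pi * Im \<tau> * (n - x)\<^sup>2)" for n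
    by (simp add: t_def norm_theta_term)
  have r: "0 < r" "r < 1 / 3" using small by (auto simp: r_def)
  have total: "(t has_sum 0) UNIV"
    using theta_char_has_sum[OF assms(1), of x "1 / 2"] by (simp only: zero t_def)
  then have "t summable_on UNIV" unfolding summable_on_def by blast
  then have "t summable_on - {0}" by (rule summable_on_subset_banach) simp
  then have rest: "(t has_sum infsum t (- {0})) (- {0})" by (rule has_sum_infsum)
  then have "(t has_sum (t 0 + infsum t (- {0}))) (insert 0 (- {0}))"
    by (rule has_sum_insert[rotated]) simp
  moreover have "insert 0 (- {0}) = (UNIV :: int set)" by auto
  ultimately have "(t has_sum (t 0 + infsum t (- {0}))) UNIV" by simp
  then have "t 0 + infsum t (- {0}) = 0"
    using total by (rule has_sum_unique)
  then have "t 0 = - infsum t (- {0})" by (simp only: eq_neg_iff_add_eq_0)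
  then have "norm (t 0) = norm (infsum t (- {0}))" by (simp only: norm_minus_cancel)
  moreover have "norm (infsum t (- {0})) \<le> norm (t 0) * (2 * r / (1 - r))"
  proof (rule norm_infsum_le)
    show "(t has_sum infsum t (- {0})) (- {0})"
      by (rule rest)
    show "((\<lambda>n. norm (t 0) * r ^ nat \<bar>n\<bar>) has_sum (norm (t 0) * (2 * r / (1 - r)))) (- {0})"
      using r by (intro has_sum_cmult_right has_sum_geometric_int) auto
    show "norm (t n) \<le> norm (t 0) * r ^ nat \<bar>n\<bar>" if "n \<in> - {0}" for n
    proof -
      define p m where "p = pi * Im \<tau>" and "m = real (nat \<bar>n\<bar>)"
      have m: "m = \<bar>real_of_int n\<bar>" by (simp add: m_def)
      \<comment> \<open>The aim is \<open>n^2 - 2 * n * x \<ge> \<bar>n\<bar> * (1 - 2 *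
        \<bar>x\<bar>)\<close>, which uses \<open>n^2 \<ge> \<bar>n\<bar>\<close> for
        integers.\<close>
      have "n * x \<le> m * \<bar>x\<bar>" unfolding m abs_mult[symmetric] by (rule abs_ge_self)
      moreover have "m * 1 \<le> m * m"
        using that unfolding m by (intro mult_left_mono) auto
      moreover have "m * m = of_int n * of_int n" unfolding m by (rule abs_mult_self_eq)
      moreover have "(n - x)\<^sup>2 = of_int n * of_int n - 2 * (n * x) + x * x"
        by (simp add: power2_eq_square algebra_simps)
      moreover have "(0 - x)\<^sup>2 = x * x" by (simp add: power2_eq_square)
      moreover have "m * (1 - 2 * \<bar>x\<bar>) = m * 1 - 2 * (m * \<bar>x\<bar>)"
        by (simp add: right_diff_distrib)
      ultimately have "m * (1 - 2 * \<bar>x\<bar>) + (0 - x)\<^sup>2 \<le> (n - x)\<^sup>2"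
        by linarith
      then have "p * (m * (1 - 2 * \<bar>x\<bar>) + (0 - x)\<^sup>2) \<le> p * (n - x)\<^sup>2"
        using assms by (intro mult_left_mono) (simp_all add: p_def)
      then have "- p * (n - x)\<^sup>2 \<le> - p * (0 - x)\<^sup>2 + m * (- p * (1 - 2 * \<bar>x\<bar>))"
        by (simp only: distrib_left mult.left_commute[of m p] mult_minus_left mult_minus_right)
      then have "- pi * Im \<tau> * (n - x)\<^sup>2 \<le>
          - pi * Im \<tau> * (0 - x)\<^sup>2 + real (nat \<bar>n\<bar>) * (- pi * Im \<tau> * (1 - 2 * \<bar>x\<bar>))"
        unfolding p_def m_def by (simp only: mult_minus_left)
      then have "norm (t n) \<le> norm (t 0) * exp (real (nat \<bar>n\<bar>) * (- pi * Im \<tau> * (1 - 2 * \<bar>x\<bar>)))"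
        unfolding norm_t of_int_0 exp_add[symmetric] exp_le_cancel_iff .
      then show ?thesis
        by (simp only: exp_of_nat_mult r_def)
    qed
  qed
  moreover have "norm (t 0) * (2 * r / (1 - r)) < norm (t 0) * 1"
  proof (rule mult_strict_left_mono)
    show "2 * r / (1 - r) < 1" using r by (simp add: divide_less_eq)
    show "0 < norm (t 0)" by (simp only: norm_t exp_gt_zero)
  qed
  ultimately show False by linarith
qed

text \<open>In the product formula with equal characteristics the second summand contains the zero
  of the odd theta function and drops out.\<close>

lemma theta_char_zero_half_mult:
  assumes "Im \<tau> > 0"
  shows "theta_char \<tau> x 0 * theta_char \<tau> x (1 / 2) =
    theta_char (2 * \<tau>) x (1 / 2) * theta_char (2 * \<tau>) 0 (1 / 2)"
proof -
  have zero: "theta_char (2 * \<tau>) (- (1 / 2)) (- (1 / 2)) = 0"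
    by (simp only: theta_char_minus theta_char_half_half)
  have even: "theta_char (2 * \<tau>) 0 (- (1 / 2)) = theta_char (2 * \<tau>) 0 (1 / 2)"
    using theta_char_minus[of "2 * \<tau>" 0 "1 / 2"] by (simp only: minus_zero)
  have x: "(x + x) / 2 = x" "(x - x) / 2 = 0" "(x - x - 1) / 2 = - (1 / 2)" by simp_all
  have "theta_char \<tau> x 0 * theta_char \<tau> x (1 / 2) =
    theta_char (2 * \<tau>) ((x + x) / 2) (0 + 1 / 2) * theta_char (2 * \<tau>) ((x - x) / 2) (0 - 1 / 2) +
    theta_char (2 * \<tau>) ((x + x - 1) / 2) (0 + 1 / 2) * theta_char (2 * \<tau>) ((x - x - 1) / 2) (0 - 1 / 2)"
    by (rule theta_char_mult[OF assms])
  also have "\<dots> = theta_char (2 * \<tau>) x (1 / 2) * theta_char (2 * \<tau>) 0 (1 / 2)"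
    unfolding x diff_0 zero even add_0_left mult_zero_right add_0_right ..
  finally show ?thesis .
qed

lemma theta_char_nonzero:
  assumes "Im \<tau> > 0" "\<bar>x\<bar> < 1 / 2"
  shows "theta_char \<tau> x 0 \<noteq> 0" "theta_char \<tau> x (1 / 2) \<noteq> 0"
proof -
  define d where "d = pi * Im \<tau> * (1 - 2 * \<bar>x\<bar>)"
  have "d > 0" using assms by (simp add: d_def)
  \<comment> \<open>This \<open>k\<close> makes
    \<open>pi * Im (2 ^ Suc k * \<tau>) * (1 - 2 * \<bar>x\<bar>)\<close> exceed \<open>4\<close>,
    hence its exponential exceed \<open>3\<close>. The bound is shown for all
    \<open>\<bar>y\<bar> \<le> \<bar>x\<bar>\<close> because it is needed at \<open>x\<close> and at
    \<open>0\<close>.\<close>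
  obtain k where "2 / d < 2 ^ k" using real_arch_pow[of 2 "2 / d"] by auto
  then have k: "2 < 2 ^ k * d" using \<open>d > 0\<close> by (simp add: field_simps)
  have "(2 :: complex) ^ Suc k = of_real (2 ^ Suc k)"
    by (simp only: of_real_power of_real_numeral)
  then have im: "Im (2 ^ Suc k * \<tau>) = 2 ^ Suc k * Im \<tau>"
    by (simp only: times_complex.sel Re_complex_of_real Im_complex_of_real mult_zero_left add_0_right)
  have "exp (- pi * Im (2 ^ Suc k * \<tau>) * (1 - 2 * \<bar>y\<bar>)) < 1 / 3" if "\<bar>y\<bar> \<le> \<bar>x\<bar>" for y
  proof -
    have "d \<le> pi * Im \<tau> * (1 - 2 * \<bar>y\<bar>)"
      unfolding d_def using that assms by (intro mult_left_mono) auto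
    then have "2 ^ k * d \<le> 2 ^ k * (pi * Im \<tau> * (1 - 2 * \<bar>y\<bar>))"
      by (intro mult_left_mono) auto
    with k have "2 * 2 < 2 * (2 ^ k * (pi * Im \<tau> * (1 - 2 * \<bar>y\<bar>)))" by linarith
    also have "\<dots> = pi * Im (2 ^ Suc k * \<tau>) * (1 - 2 * \<bar>y\<bar>)" unfolding im by simp
    finally have "4 < pi * Im (2 ^ Suc k * \<tau>) * (1 - 2 * \<bar>y\<bar>)" by simp
    then have "3 < exp (pi * Im (2 ^ Suc k * \<tau>) * (1 - 2 * \<bar>y\<bar>))"
      by (smt (verit) exp_ge_add_one_self)
    then have "inverse (exp (pi * Im (2 ^ Suc k * \<tau>) * (1 - 2 * \<bar>y\<bar>))) < inverse 3"
      by (intro less_imp_inverse_less) auto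
    then show ?thesis by (simp flip: exp_minus)
  qed
  moreover have "Im (2 ^ Suc k * \<tau>) > 0"
    unfolding im using assms by simp
  ultimately have "theta_char (2 ^ Suc k * \<tau>) x (1 / 2) \<noteq> 0" "theta_char (2 ^ Suc k * \<tau>) 0 (1 / 2) \<noteq> 0"
    using theta_char_half_nonzero_if_large[of "2 ^ Suc k * \<tau>" x] theta_char_half_nonzero_if_large[of "2 ^ Suc k * \<tau>" 0] assms(2)
    by (metis order_refl, metis abs_zero abs_ge_zero order_le_less_trans)
  \<comment> \<open>The doubling identity brings in a factor with characteristic \<open>0\<close>,
    so the induction carries the claims for \<open>x\<close> and for \<open>0\<close> together while
    descending from \<open>2 * \<tau>\<close> to \<open>\<tau>\<close>.\<close>
  then have "theta_char \<tau> x 0 * theta_char \<tau> x (1 / 2) \<noteq> 0 \<and> theta_char \<tau> 0 0 * theta_char \<tau> 0 (1 / 2) \<noteq> 0"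
    using assms(1)
  proof (induction k arbitrary: \<tau>)
    case 0
    then show ?case by (simp add: theta_char_zero_half_mult)
  next
    case (Suc k)
    have *: "2 ^ Suc k * (2 * \<tau>) = 2 ^ Suc (Suc k) * \<tau>" by simp
    have "Im (2 * \<tau>) > 0" using Suc.prems by simp
    then have "theta_char (2 * \<tau>) x (1 / 2) \<noteq> 0" "theta_char (2 * \<tau>) 0 (1 / 2) \<noteq> 0"
      using Suc.IH[of "2 * \<tau>", unfolded *, OF Suc.prems(1,2)] by auto
    with Suc.prems(3) show ?case
      by (simp only: theta_char_zero_half_mult) simp
  qed
  then show "theta_char \<tau> x 0 \<noteq> 0" "theta_char \<tau> x (1 / 2) \<noteq> 0" by auto
qed


subsection \<open>Products of theta functions\<close>

lemma theta_eq_theta_char: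
  assumes "N > 0"
  shows "theta N k z \<tau> = theta_char (of_int N * \<tau>) (of_int k / of_int N - 1 / 2) (of_int N * (z + 1 / 2))"
  unfolding theta_def theta_char_def theta_term_def
  by (intro infsum_cong arg_cong[where f = e_exp]) (simp add: algebra_simps)

lemma theta_mod:
  assumes "N > 0"
  shows "theta N (k mod N) z \<tau> = theta N k z \<tau>"
proof -
  have "real_of_int k = of_int (k mod N) + of_int N * of_int (k div N)"
    by (metis mod_mult_div_eq of_int_add of_int_mult)
  then have "real_of_int k / of_int N - 1 / 2 = (of_int (k mod N) / of_int N - 1 / 2) + of_int (k div N)"
    using assms by (simp add: field_simps)
  then show ?thesis
    by (simp only: theta_eq_theta_char[OF assms] theta_char_periodic)
qed

lemma theta_cong:
  assumes "N > 0" "i mod N = j mod N"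
  shows "theta N i z \<tau> = theta N j z \<tau>"
  using assms theta_mod by metis

text \<open>The factor \<open>g\<close> may depend on \<open>z\<close> and \<open>k\<close> but not
  on \<open>i\<close>: projectively, translation by a torsion point rotates the coordinates.\<close>

lemma theta_shift:
  assumes "N > 0"
  obtains g where "g \<noteq> 0"
    "\<And>i. theta N (i + k) z \<tau> = g * theta N i (z - of_int k * \<tau> / of_int N) \<tau>"
proof
  define y where "y = real_of_int k / of_int N"
  define g where "g = e_exp (of_int N * \<tau> * (of_real y)\<^sup>2 / 2 - of_real y * (of_int N * (z + 1 / 2)))"
  show "g \<noteq> 0" by (simp add: g_def)
  show "theta N (i + k) z \<tau> = g * theta N i (z - of_int k * \<tau> / of_int N) \<tau>" for i
  proof -
    have "real_of_int (i + k) / of_int N - 1 / 2 = (of_int i / of_int N - 1 / 2) + y"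
      by (simp add: y_def add_divide_distrib)
    moreover have "of_int N * (z + 1 / 2) - of_real y * (of_int N * \<tau>) =
        of_int N * ((z - of_int k * \<tau> / of_int N) + 1 / 2)"
      using assms by (simp add: y_def field_simps)
    ultimately show ?thesis
      by (simp only: theta_eq_theta_char[OF assms] theta_char_shift g_def)
  qed
qed

section \<open>Theta functions of even level\<close>

locale even_theta =
  fixes N h :: int and \<tau> :: complex
  assumes N_eq: "N = 2 * h" and h_ge: "h \<ge> 2" and tau: "Im \<tau> > 0"
begin

lemma N_pos: "N > 0" using N_eq h_ge by simp

lemma Im_pos: "Im (of_int N * \<tau>) > 0" "Im (2 * (of_int N * \<tau>)) > 0" "Im (of_int N * \<tau> / 2) > 0"
  using N_pos tau by auto

text \<open>Half-sums and half-differences of the characteristics \<open>i / N - 1 / 2\<close> are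
  integer multiples of \<open>1 / (2 * N)\<close>; the integer argument of \<open>\<beta>\<close>
  and \<open>A\<close> counts these units.\<close>

definition \<beta> :: "int \<Rightarrow> complex" where
  "\<beta> m = theta_char (2 * (of_int N * \<tau>)) (of_int m / (2 * of_int N)) 0"

definition A :: "int \<Rightarrow> complex \<Rightarrow> complex" where
  "A m z = theta_char (2 * (of_int N * \<tau>)) (of_int m / (2 * of_int N)) (2 * (of_int N * (z + 1 / 2)))"

lemma divide_add_2N: "real_of_int (m + 2 * N) / (2 * of_int N) = of_int m / (2 * of_int N) + of_int 1"
  using N_pos by (simp add: field_simps)

lemma \<beta>_periodic [simp]: "\<beta> (m + 2 * N) = \<beta> m"
  unfolding \<beta>_def divide_add_2N theta_char_periodic ..

lemma A_periodic: "A (m + 2 * N) z = A m z"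
  unfolding A_def divide_add_2N theta_char_periodic ..

lemma \<beta>_minus: "\<beta> (- m) = \<beta> m"
  using theta_char_minus[of "2 * (of_int N * \<tau>)" "of_int m / (2 * of_int N)" 0]
  by (simp add: \<beta>_def)

lemma \<beta>_diff_N: "\<beta> (m - N) = \<beta> (m + N)"
  using \<beta>_periodic[of "m - N"] by (simp add: algebra_simps)

text \<open>Both factors have the same argument, so in the product formula the difference of
  arguments is \<open>0\<close> and the theta functions with half-difference characteristics become
  constants.\<close>

lemma theta_mult:
  "theta N i z \<tau> * theta N j z \<tau> = A (i + j - N) z * \<beta> (i - j) + A (i + j) z * \<beta> (i - j + N)"
proof -
  define x y w where "x = real_of_int i / of_int N - 1 / 2" and "y = real_of_int j / of_int N - 1 / 2"
    and "w = of_int N * (z + 1 / 2)"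
  have "(x + y) / 2 = of_int (i + j - N) / (2 * of_int N)"
    "(x - y) / 2 = of_int (i - j) / (2 * of_int N)"
    "(x + y - 1) / 2 = of_int (i + j - 2 * N) / (2 * of_int N)"
    "(x - y - 1) / 2 = of_int (i - j - N) / (2 * of_int N)"
    using N_pos by (simp_all add: x_def y_def field_simps)
  moreover have "w + w = 2 * (of_int N * (z + 1 / 2))" "w - w = 0" by (simp_all add: w_def)
  ultimately have "theta N i z \<tau> * theta N j z \<tau> =
      A (i + j - N) z * \<beta> (i - j) + A (i + j - 2 * N) z * \<beta> (i - j - N)"
    using theta_char_mult[OF Im_pos(1), of x w y w]
    by (simp only: theta_eq_theta_char[OF N_pos] x_def[symmetric] y_def[symmetric] w_def[symmetric]
        \<beta>_def A_def)
  then show ?thesis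
    using A_periodic[of "i + j - 2 * N" z] by (simp add: \<beta>_diff_N)
qed

lemma A_zero: "A m 0 = e_exp (of_int m / 2) * \<beta> m"
proof -
  have "2 * (of_int N * (0 + 1 / 2)) = 0 + complex_of_int N" by simp
  then have "A m 0 = e_exp (- of_int N * of_real (of_int m / (2 * of_int N))) * \<beta> m"
    unfolding A_def \<beta>_def by (simp only: theta_char_add_int)
  moreover have "- of_int N * complex_of_real (of_int m / (2 * of_int N)) = of_int (- m) / 2"
    using N_pos by simp
  ultimately show ?thesis
    by (simp only: e_exp_of_int_half even_minus)
qed

lemma theta_zero_mult:
  "theta N (i + k) 0 \<tau> * theta N i 0 \<tau> =
     e_exp (of_int k / 2) * (\<beta> (2 * i + k + N) * \<beta> k + \<beta> (2 * i + k) * \<beta> (k + N))"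
proof -
  \<comment> \<open>Evenness of \<open>N\<close> makes the two values of \<open>A\<close> at
    \<open>0\<close> carry the same exponential factor.\<close>
  have "even N" using N_eq by simp
  then have "e_exp (of_int (2 * i + k - N) / 2) = e_exp (of_int k / 2)"
    "e_exp (of_int (2 * i + k) / 2) = e_exp (of_int k / 2)"
    by (simp_all only: e_exp_of_int_half even_add even_diff_iff even_mult_iff) simp_all
  moreover have "i + k + i = 2 * i + k" "i + k - i = k" by simp_all
  ultimately show ?thesis
    by (simp only: theta_mult A_zero) (simp add: \<beta>_diff_N algebra_simps)
qed

end

text \<open>The parameter \<open>\<epsilon>\<close> treats \<open>V\<^sub>0\<close> and \<open>V\<^sub>1\<close> simultaneously.\<close>

locale even_theta_parity = even_theta +
  fixes \<epsilon> :: int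
  assumes \<epsilon>: "\<epsilon> = 0 \<or> \<epsilon> = 1"
begin

text \<open>Replacing \<open>j\<close> by \<open>h - \<epsilon> - j\<close> exchanges
  \<open>\<beta> (2 * j + \<epsilon>)\<close> and \<open>\<beta> (2 * j + \<epsilon> + N)\<close>,
  and so does replacing \<open>j\<close> by \<open>h + j\<close>. The four-term relations rest on
  this.\<close>

lemma \<beta>_reflect: "\<beta> (2 * (h - \<epsilon> - j) + \<epsilon>) = \<beta> (2 * j + \<epsilon> + N)"
proof -
  have "2 * (h - \<epsilon> - j) + \<epsilon> = - (2 * j + \<epsilon> - N)" by (simp add: N_eq)
  then show ?thesis by (simp only: \<beta>_minus \<beta>_diff_N)
qed

lemma \<beta>_reflect': "\<beta> (2 * (h - \<epsilon> - j) + \<epsilon> + N) = \<beta> (2 * j + \<epsilon>)"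
proof -
  have "2 * (h - \<epsilon> - j) + \<epsilon> + N = - (2 * j + \<epsilon>) + 2 * N" by (simp add: N_eq)
  then show ?thesis by (simp only: \<beta>_minus \<beta>_periodic)
qed

lemma \<beta>_shift_h: "\<beta> (2 * (h + j) + \<epsilon>) = \<beta> (2 * j + \<epsilon> + N)" "\<beta> (2 * (h + j) + \<epsilon> + N) = \<beta> (2 * j + \<epsilon>)"
proof -
  have "2 * (h + j) + \<epsilon> = 2 * j + \<epsilon> + N" "2 * (h + j) + \<epsilon> + N = 2 * j + \<epsilon> + 2 * N" by (simp_all add: N_eq)
  then show "\<beta> (2 * (h + j) + \<epsilon>) = \<beta> (2 * j + \<epsilon> + N)" "\<beta> (2 * (h + j) + \<epsilon> + N) = \<beta> (2 * j + \<epsilon>)"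
    by (simp_all only: \<beta>_periodic)
qed

text \<open>Modulo \<open>N\<close> every pair of indices with sum \<open>\<epsilon>\<close> has the
  form \<open>(j + \<epsilon>, - j)\<close>.\<close>

definition F :: "int \<Rightarrow> complex \<Rightarrow> complex" where
  "F j z = theta N (j + \<epsilon>) z \<tau> * theta N (- j) z \<tau>"

definition a2 :: "int \<Rightarrow> complex" where
  "a2 j = theta N j 0 \<tau> * theta N (j + \<epsilon>) 0 \<tau>"

lemma F_eq: "F j z = A (\<epsilon> - N) z * \<beta> (2 * j + \<epsilon>) + A \<epsilon> z * \<beta> (2 * j + \<epsilon> + N)"
  unfolding F_def theta_mult by (simp add: algebra_simps)

lemma a2_eq: "a2 j = e_exp (of_int \<epsilon> / 2) *
    (\<beta> (2 * j + \<epsilon> + N) * \<beta> \<epsilon> + \<beta> (2 * j + \<epsilon>) * \<beta> (\<epsilon> + N))"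
  unfolding a2_def mult.commute[of "theta N j 0 \<tau>"] by (rule theta_zero_mult)

text \<open>Let \<open>b\<close>, \<open>c\<close> be \<open>\<beta> \<epsilon>\<close>,
  \<open>\<beta> (\<epsilon> + N)\<close> and \<open>p\<close>, \<open>q\<close> be
  \<open>\<beta> (2 * j + \<epsilon>)\<close>, \<open>\<beta> (2 * j + \<epsilon> + N)\<close>. The
  coefficient of \<open>A (\<epsilon> - N) z\<close> vanishes because
  \<open>(q b + p c) b + (p b + q c) c = 2 b c p + (b^2 + c^2) q\<close>; that of
  \<open>A \<epsilon> z\<close> is the same with \<open>p\<close> and \<open>q\<close>
  exchanged.\<close>

lemma F_relation:
  "a2 j * F 0 z + a2 (h + j) * F (h - \<epsilon>) z - a2 0 * F j z - a2 h * F (h - \<epsilon> - j) z = 0"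
  using \<beta>_reflect[of 0] \<beta>_reflect'[of 0] \<beta>_reflect[of j] \<beta>_reflect'[of j] \<beta>_shift_h[of j] \<beta>_shift_h[of 0]
  by (simp add: F_eq a2_eq) (simp add: algebra_simps)

lemma \<beta>_add_nonzero: "\<beta> \<epsilon> + \<beta> (\<epsilon> + N) \<noteq> 0" and \<beta>_diff_nonzero: "\<beta> \<epsilon> - \<beta> (\<epsilon> + N) \<noteq> 0"
proof -
  define x where "x = real_of_int \<epsilon> / of_int N"
  define t where "t = of_int N * \<tau> / 2"
  have "\<bar>x\<bar> < 1 / 2"
    using \<epsilon> N_eq h_ge by (auto simp: x_def field_simps)
  note nz = theta_char_nonzero[OF Im_pos(3) this, folded t_def]
  have t: "4 * t = 2 * (of_int N * \<tau>)" by (simp add: t_def)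
  have x: "x / 2 = of_int \<epsilon> / (2 * of_int N)" "(x - 1) / 2 = of_int (\<epsilon> - N) / (2 * of_int N)"
    using N_pos by (simp_all add: x_def field_simps)
  note split = theta_char_split[OF Im_pos(3), folded t_def, unfolded t]
  have "theta_char t x 0 = \<beta> \<epsilon> + \<beta> (\<epsilon> - N)"
    unfolding split[of x 0] mult_zero_right \<beta>_def x ..
  with nz show "\<beta> \<epsilon> + \<beta> (\<epsilon> + N) \<noteq> 0" by (simp add: \<beta>_diff_N)
  have "theta_char (4 * t) y (2 * (1 / 2)) = e_exp (- of_real y) * theta_char (4 * t) y 0" for y
    using theta_char_add_int[of "4 * t" y 0 1] by simp
  then have "theta_char t x (1 / 2) =
      e_exp (- of_real (x / 2)) * \<beta> \<epsilon> + e_exp (- of_real ((x - 1) / 2)) * \<beta> (\<epsilon> - N)"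
    unfolding t split[of x "1 / 2"] \<beta>_def x by simp
  \<comment> \<open>The extra \<open>1 / 2\<close> contributes the factor \<open>-1\<close> that
    turns the sum into a difference.\<close>
  also have "- of_real ((x - 1) / 2) = - of_real (x / 2) + (1 / 2 :: complex)"
    by (simp add: field_simps)
  finally have "theta_char t x (1 / 2) = e_exp (- of_real (x / 2)) * (\<beta> \<epsilon> - \<beta> (\<epsilon> + N))"
    unfolding e_exp_add e_exp_half \<beta>_diff_N by (simp add: algebra_simps)
  with nz show "\<beta> \<epsilon> - \<beta> (\<epsilon> + N) \<noteq> 0" by auto
qed

text \<open>Up to a common nonzero factor, \<open>a2 0\<close> is \<open>2 b c\<close> and
  \<open>a2 h\<close> is \<open>b^2 + c^2\<close>, so the difference of squares is
  \<open>(b + c)^2 (b - c)^2\<close>.\<close>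

lemma a2_sq_neq: "(a2 0)\<^sup>2 \<noteq> (a2 h)\<^sup>2"
proof
  define b c s where "b = \<beta> \<epsilon>" and "c = \<beta> (\<epsilon> + N)" and "s = e_exp (of_int \<epsilon> / 2)"
  have "a2 0 = s * (c * b + b * c)" by (simp add: a2_eq b_def c_def s_def)
  moreover have "a2 h = s * (b * b + c * c)"
    using \<beta>_shift_h[of 0] by (simp add: a2_eq b_def c_def s_def)
  ultimately have "(a2 h)\<^sup>2 - (a2 0)\<^sup>2 = s\<^sup>2 * (b + c)\<^sup>2 * (b - c)\<^sup>2"
    by (simp add: power2_eq_square algebra_simps)
  moreover assume "(a2 0)\<^sup>2 = (a2 h)\<^sup>2"
  ultimately show False
    using \<beta>_add_nonzero \<beta>_diff_nonzero by (simp add: b_def c_def s_def)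
qed

text \<open>Up to a nonzero factor, translation by half a period swaps the values of
  \<open>F 0\<close> and \<open>F (h - \<epsilon>)\<close> at \<open>0\<close>, which gives a
  symmetric system for \<open>u\<close>, \<open>v\<close> with determinant
  \<open>(a2 0)\<^sup>2 - (a2 h)\<^sup>2\<close>.\<close>

lemma F_independent:
  assumes zero: "\<And>z. u * F 0 z + v * F (h - \<epsilon>) z = 0"
  shows "u = 0" "v = 0"
proof -
  have cong: "theta N (\<epsilon> - h) z \<tau> = theta N (h + \<epsilon>) z \<tau>" for z
    by (rule theta_cong[OF N_pos]) (metis N_eq add.commute add_diff_cancel_left' diff_add_eq mod_add_self2 mult_2 uminus_add_conv_diff)
  \<comment> \<open>The points \<open>z = 0\<close> and \<open>z = - \<tau> / 2\<close> give two independent equations.\<close>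
  have at_0: "u * a2 0 + v * a2 h = 0"
    using zero[of 0] cong[of 0] by (simp add: F_def a2_def mult.commute)
  obtain g where g: "g \<noteq> 0" and shift: "\<And>i. theta N (i + h) 0 \<tau> = g * theta N i (0 - of_int h * \<tau> / of_int N) \<tau>"
    using theta_shift[OF N_pos] by blast
  define w where "w = 0 - of_int h * \<tau> / of_int N"
  have "g\<^sup>2 * F 0 w = a2 h"
    using shift[of \<epsilon>] shift[of 0] by (simp add: F_def a2_def w_def power2_eq_square add.commute)
  moreover have "g\<^sup>2 * F (h - \<epsilon>) w = a2 0"
  proof -
    have "theta N (h + h) 0 \<tau> = theta N 0 0 \<tau>"
      by (rule theta_cong[OF N_pos]) (simp add: N_eq)
    then show ?thesis
      using shift[of h] shift[of "\<epsilon> - h"] by (simp add: F_def a2_def w_def power2_eq_square)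
  qed
  moreover have "g\<^sup>2 * (u * F 0 w + v * F (h - \<epsilon>) w) = 0" by (simp add: zero)
  ultimately have at_h: "u * a2 h + v * a2 0 = 0"
    by (simp add: algebra_simps)
  have "u * ((a2 0)\<^sup>2 - (a2 h)\<^sup>2) = (u * a2 0 + v * a2 h) * a2 0 - (u * a2 h + v * a2 0) * a2 h"
    "v * ((a2 0)\<^sup>2 - (a2 h)\<^sup>2) = (u * a2 h + v * a2 0) * a2 0 - (u * a2 0 + v * a2 h) * a2 h"
    by (simp_all add: power2_eq_square algebra_simps)
  then have "u * ((a2 0)\<^sup>2 - (a2 h)\<^sup>2) = 0" "v * ((a2 0)\<^sup>2 - (a2 h)\<^sup>2) = 0"
    unfolding at_0 at_h by simp_all
  with a2_sq_neq show "u = 0" "v = 0" by simp_all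
qed

end


subsection \<open>Quadratic forms and rotation of the coordinates\<close>

lemma eval_poly_superset:
  assumes "finite B" "Poly_Mapping.keys p \<subseteq> B"
  shows "eval_poly p v =
    (\<Sum>m\<in>B. Poly_Mapping.lookup p m * (\<Prod>i\<in>Poly_Mapping.keys m. v i ^ Poly_Mapping.lookup m i))"
  unfolding eval_poly_def using assms
  by (intro sum.mono_neutral_left) (auto simp: in_keys_iff)

lemma eval_poly_add: "eval_poly (p + q) v = eval_poly p v + eval_poly q v"
  using keys_add[of p q]
  by (subst (1 2 3) eval_poly_superset[of "Poly_Mapping.keys p \<union> Poly_Mapping.keys q"])
     (auto simp: lookup_add sum.distrib algebra_simps)

lemma eval_poly_scale: "eval_poly (poly_scale c p) v = c * eval_poly p v"
  by (subst (1 2) eval_poly_superset[of "Poly_Mapping.keys p"])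
     (auto simp: in_keys_iff sum_distrib_left algebra_simps)

lemma eval_poly_zero [simp]: "eval_poly 0 v = 0"
  by (simp add: eval_poly_def)

lemma eval_poly_diff: "eval_poly (p - q) v = eval_poly p v - eval_poly q v"
  using eval_poly_add[of "p - q" q v] by simp

section \<open>Quadratic monomials graded by their index sum\<close>

definition quad_monomial :: "int \<Rightarrow> int \<Rightarrow> int \<Rightarrow> int \<Rightarrow>\<^sub>0 nat" where
  "quad_monomial N i j = Poly_Mapping.single (i mod N) 1 + Poly_Mapping.single (j mod N) 1"

lemma coord_mult: "coord N i * coord N j = Poly_Mapping.single (quad_monomial N i j) 1"
  by (simp add: coord_def quad_monomial_def mult_single)

lemma coord_cong: "i mod N = j mod N \<Longrightarrow> coord N i = coord N j"
  by (simp add: coord_def)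

lemma keys_quad_monomial: "Poly_Mapping.keys (quad_monomial N i j) = {i mod N, j mod N}"
  by (auto simp: quad_monomial_def in_keys_iff lookup_add lookup_single when_def split: if_splits)

lemma eval_coord_mult: "eval_poly (coord N i * coord N j) v = v (i mod N) * v (j mod N)"
proof -
  have "eval_poly (coord N i * coord N j) v =
      (\<Prod>l\<in>{i mod N, j mod N}. v l ^ Poly_Mapping.lookup (quad_monomial N i j) l)"
    by (simp add: coord_mult eval_poly_def keys_quad_monomial)
  \<comment> \<open>For congruent \<open>i\<close>, \<open>j\<close> the index set is a singleton
    and the exponent is \<open>2\<close>.\<close>
  then show ?thesis
    by (cases "i mod N = j mod N")
      (simp_all add: quad_monomial_def lookup_add lookup_single when_def power2_eq_square)
qed

definition quad_span :: "int \<Rightarrow> int \<Rightarrow> cpoly set" where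
  "quad_span N k = cpoly.span {coord N i * coord N j | i j. (i + j) mod N = k mod N}"

lemma coord_mult_in_quad_span:
  "(i + j) mod N = k mod N \<Longrightarrow> coord N i * coord N j \<in> quad_span N k"
  unfolding quad_span_def by (rule cpoly.span_base) blast

lemma subspace_quad_span: "cpoly.subspace (quad_span N k)"
  by (simp add: quad_span_def)

lemma quad_span_induct [consumes 1, case_names zero add scale base]:
  assumes "p \<in> quad_span N k"
    and "P 0" "\<And>p q. P p \<Longrightarrow> P q \<Longrightarrow> P (p + q)" "\<And>c p. P p \<Longrightarrow> P (poly_scale c p)"
    and base: "\<And>i j. (i + j) mod N = k mod N \<Longrightarrow> P (coord N i * coord N j)"
  shows "P p"
proof -
  have "cpoly.subspace {p. P p}"
    using assms(2-4) by (auto simp: cpoly.subspace_def)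
  then have "quad_span N k \<subseteq> {p. P p}"
    unfolding quad_span_def using base by (intro cpoly.span_minimal) auto
  with assms(1) show ?thesis by auto
qed

lemma quad_span_subset_quadratic_forms:
  assumes "N > 0" "p \<in> quad_span N k"
  shows "p \<in> quadratic_forms N"
  using assms(2)
proof (induction rule: quad_span_induct)
  case zero
  show ?case by (simp add: quadratic_forms_def)
next
  case (add p q)
  then show ?case using keys_add[of p q] by (auto simp: quadratic_forms_def)
next
  case (scale c p)
  then show ?case by (auto simp: quadratic_forms_def in_keys_iff)
next
  case (base i j)
  have "(\<Sum>l\<in>{i mod N, j mod N}. Poly_Mapping.lookup (quad_monomial N i j) l) = 2"
    by (cases "i mod N = j mod N")
      (simp_all add: quad_monomial_def lookup_add lookup_single when_def)
  with assms(1) show ?case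
    by (auto simp: quadratic_forms_def coord_mult keys_quad_monomial)
qed

lemma eval_poly_quad_span_scale:
  assumes "p \<in> quad_span N k"
  shows "eval_poly p (\<lambda>i. c * v i) = c\<^sup>2 * eval_poly p v"
  using assms
  by (induction rule: quad_span_induct)
     (auto simp: eval_poly_add eval_poly_scale eval_coord_mult algebra_simps power2_eq_square)

text \<open>By homogeneity of degree \<open>2\<close>, vanishing on all nonzero multiples of a
  vector is vanishing at the vector itself.\<close>

lemma graded_quadrics_iff:
  assumes "N > 0"
  shows "p \<in> graded_quadrics N \<tau> k \<longleftrightarrow>
    p \<in> quad_span N k \<and> (\<forall>z. eval_poly p (theta_vec N \<tau> z) = 0)"
proof (cases "p \<in> quad_span N k")
  case True
  have "(\<forall>P\<in>theta_curve N \<tau>. \<forall>v\<in>P. eval_poly p v = 0) \<longleftrightarrow>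
      (\<forall>z c. c \<noteq> 0 \<longrightarrow> eval_poly p (\<lambda>i. c * theta_vec N \<tau> z i) = 0)"
    by (auto simp: theta_curve_def proj_point_def)
  also have "\<dots> \<longleftrightarrow> (\<forall>z. eval_poly p (theta_vec N \<tau> z) = 0)"
    by (auto simp: eval_poly_quad_span_scale[OF True] intro: exI[of _ 1])
  finally show ?thesis
    using True quad_span_subset_quadratic_forms[OF assms True]
    by (simp add: graded_quadrics_def vanishing_quadrics_def quad_span_def)
next
  case False
  then show ?thesis by (simp add: graded_quadrics_def quad_span_def)
qed

lemma subspace_graded_quadrics:
  assumes "N > 0"
  shows "cpoly.subspace (graded_quadrics N \<tau> k)"
  using subspace_quad_span[of N k]
  by (auto simp: cpoly.subspace_def graded_quadrics_iff[OF assms] eval_poly_add eval_poly_scale)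

lemma eval_coord_mult_theta:
  assumes "N > 0"
  shows "eval_poly (coord N i * coord N j) (theta_vec N \<tau> z) = theta N i z \<tau> * theta N j z \<tau>"
  using assms by (simp add: eval_coord_mult theta_vec_def theta_mod)

section \<open>Rotation of the coordinates as a linear map\<close>

definition rotate_index :: "int \<Rightarrow> int \<Rightarrow> int \<Rightarrow> int" where
  "rotate_index N k i = (if i \<in> {0..<N} then (i + k) mod N else i)"

lemma rotate_index_mod: "N > 0 \<Longrightarrow> rotate_index N k (i mod N) = (i + k) mod N"
  by (simp add: rotate_index_def mod_add_left_eq)

lemma rotate_index_inverse:
  assumes "N > 0"
  shows "rotate_index N k (rotate_index N (- k) i) = i"
proof (cases "i \<in> {0..<N}")
  case True
  then have "rotate_index N k (rotate_index N (- k) i) = rotate_index N k ((i - k) mod N)"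
    by (simp add: rotate_index_def)
  also have "\<dots> = i" using True assms by (simp add: rotate_index_mod)
  finally show ?thesis .
next
  case False
  then show ?thesis by (auto simp: rotate_index_def)
qed

text \<open>Integers outside \<open>{0..<N}\<close> are fixed, so the rotation permutes all of them
  and pullback along it is injective.\<close>

lemma bij_rotate_index: "N > 0 \<Longrightarrow> bij (rotate_index N k)"
  using rotate_index_inverse[of N k] rotate_index_inverse[of N "- k"]
  by (intro o_bij[of "rotate_index N (- k)"]) auto

text \<open>\<open>map_key\<close> is a pullback: the inner one lowers indices by \<open>k\<close>,
  and pulling back along it in turn raises them by \<open>k\<close>.\<close>

definition rotate_poly :: "int \<Rightarrow> int \<Rightarrow> cpoly \<Rightarrow> cpoly" where
  "rotate_poly N k = Poly_Mapping.map_key (Poly_Mapping.map_key (rotate_index N k))"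

lemma inj_map_key:
  assumes "bij f"
  shows "inj (Poly_Mapping.map_key f :: ('a \<Rightarrow>\<^sub>0 'c::zero) \<Rightarrow> _)"
proof (rule injI)
  fix p q :: "'a \<Rightarrow>\<^sub>0 'c"
  assume eq: "Poly_Mapping.map_key f p = Poly_Mapping.map_key f q"
  have "Poly_Mapping.lookup p (f x) = Poly_Mapping.lookup q (f x)" for x
    using arg_cong[OF eq, of "\<lambda>r. Poly_Mapping.lookup r x"] assms
    by (simp add: map_key.rep_eq bij_is_inj)
  then show "p = q"
    using assms by (intro poly_mapping_eqI) (metis bij_pointE)
qed

context
  fixes N :: int
  assumes N: "N > 0"
begin

lemma inj_map_key_rotate_index: "inj (Poly_Mapping.map_key (rotate_index N k) :: (int \<Rightarrow>\<^sub>0 nat) \<Rightarrow> _)"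
  by (rule inj_map_key[OF bij_rotate_index[OF N]])

lemma rotate_poly_add: "rotate_poly N k (p + q) = rotate_poly N k p + rotate_poly N k q"
  unfolding rotate_poly_def by (rule map_key_plus[OF inj_map_key_rotate_index])

lemma rotate_poly_scale: "rotate_poly N k (poly_scale c p) = poly_scale c (rotate_poly N k p)"
  unfolding rotate_poly_def
  by (rule poly_mapping_eqI) (simp add: map_key.rep_eq inj_map_key_rotate_index)

lemma linear_rotate_poly: "Vector_Spaces.linear poly_scale poly_scale (rotate_poly N k)"
  by unfold_locales (simp_all add: rotate_poly_add rotate_poly_scale)

lemma rotate_poly_coord_mult:
  "rotate_poly N k (coord N i * coord N j) = coord N (i + k) * coord N (j + k)"
proof -
  have inj: "inj (rotate_index N k)" using bij_rotate_index[OF N] by (rule bij_is_inj)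
  have "Poly_Mapping.map_key (rotate_index N k) (Poly_Mapping.single ((l + k) mod N) 1)
      = Poly_Mapping.single (l mod N) (1 :: nat)" for l
    using map_key_single[OF inj, of "l mod N" "1 :: nat"] by (simp add: rotate_index_mod[OF N])
  then have "Poly_Mapping.map_key (rotate_index N k) (quad_monomial N (i + k) (j + k)) = quad_monomial N i j"
    by (simp add: quad_monomial_def map_key_plus[OF inj])
  then show ?thesis
    unfolding coord_mult rotate_poly_def
    using map_key_single[OF inj_map_key_rotate_index, of k "quad_monomial N (i + k) (j + k)" "1 :: complex"]
    by simp
qed

lemma rotate_poly_in_quad_span:
  assumes "p \<in> quad_span N r"
  shows "rotate_poly N k p \<in> quad_span N (r + 2 * k)"
  using assms
proof (induction rule: quad_span_induct)
  case zero
  show ?case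
    using rotate_poly_scale[of k 0 0] by (simp add: cpoly.subspace_0[OF subspace_quad_span])
next
  case (add p q)
  then show ?case by (simp add: rotate_poly_add cpoly.subspace_add[OF subspace_quad_span])
next
  case (scale c p)
  then show ?case by (simp add: rotate_poly_scale cpoly.subspace_scale[OF subspace_quad_span])
next
  case (base i j)
  then have "(i + j + 2 * k) mod N = (r + 2 * k) mod N" by (rule mod_add_cong) simp
  then show ?case
    unfolding rotate_poly_coord_mult by (intro coord_mult_in_quad_span) (simp add: algebra_simps)
qed

lemma rotate_poly_zero [simp]: "rotate_poly N k 0 = 0"
  using rotate_poly_scale[of k 0 0] by simp

lemma rotate_poly_inverse:
  assumes "p \<in> quad_span N r"
  shows "rotate_poly N (- k) (rotate_poly N k p) = p"
  using assms
  by (induction rule: quad_span_induct)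
     (simp_all add: rotate_poly_add rotate_poly_scale rotate_poly_coord_mult)

text \<open>The value of the rotated form at the point of \<open>z\<close> is
  \<open>g\<^sup>2\<close> times the value of \<open>p\<close> at the point of
  \<open>z - k \<tau> / N\<close>, where \<open>p\<close> vanishes.\<close>

lemma rotate_poly_graded_quadrics:
  assumes "p \<in> graded_quadrics N \<tau> r"
  shows "rotate_poly N k p \<in> graded_quadrics N \<tau> (r + 2 * k)"
proof -
  from assms have p: "p \<in> quad_span N r" and zero: "\<And>z. eval_poly p (theta_vec N \<tau> z) = 0"
    by (auto simp: graded_quadrics_iff[OF N])
  have "eval_poly (rotate_poly N k p) (theta_vec N \<tau> z) = 0" for z
  proof -
    define w where "w = z - of_int k * \<tau> / of_int N"
    obtain g where g: "\<And>i. theta N (i + k) z \<tau> = g * theta N i w \<tau>"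
      using theta_shift[OF N] unfolding w_def by blast
    have "eval_poly (rotate_poly N k p) (theta_vec N \<tau> z) = g\<^sup>2 * eval_poly p (theta_vec N \<tau> w)"
      using p
      by (induction rule: quad_span_induct)
         (simp_all add: rotate_poly_add rotate_poly_scale rotate_poly_coord_mult eval_poly_add
           eval_poly_scale eval_coord_mult_theta[OF N] g algebra_simps power2_eq_square)
    then show ?thesis by (simp add: zero)
  qed
  with rotate_poly_in_quad_span[OF p] show ?thesis
    by (auto simp: graded_quadrics_iff[OF N])
qed

lemma bij_betw_rotate_poly:
  "bij_betw (rotate_poly N k) (graded_quadrics N \<tau> r) (graded_quadrics N \<tau> (r + 2 * k))"
proof (rule bij_betwI)
  show "rotate_poly N k \<in> graded_quadrics N \<tau> r \<rightarrow> graded_quadrics N \<tau> (r + 2 * k)"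
    using rotate_poly_graded_quadrics by blast
  show "rotate_poly N (- k) \<in> graded_quadrics N \<tau> (r + 2 * k) \<rightarrow> graded_quadrics N \<tau> r"
    using rotate_poly_graded_quadrics[of _ \<tau> "r + 2 * k" "- k"] by auto
  show "rotate_poly N (- k) (rotate_poly N k p) = p" if "p \<in> graded_quadrics N \<tau> r" for p
    using that rotate_poly_inverse by (auto simp: graded_quadrics_iff[OF N])
  show "rotate_poly N k (rotate_poly N (- k) p) = p" if "p \<in> graded_quadrics N \<tau> (r + 2 * k)" for p
    using that rotate_poly_inverse[of p _ "- k"] by (auto simp: graded_quadrics_iff[OF N])
qed

end

lemma basis_familyI:
  assumes I: "finite I"
    and indep: "\<And>d i. (\<Sum>j\<in>I. poly_scale (d j) (f j)) = 0 \<Longrightarrow> i \<in> I \<Longrightarrow> d i = 0"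
    and W: "cpoly.subspace W" "\<And>i. i \<in> I \<Longrightarrow> f i \<in> W"
    and span: "\<And>p. p \<in> W \<Longrightarrow> \<exists>d. p = (\<Sum>j\<in>I. poly_scale (d j) (f j))"
  shows "basis_family f I W"
proof -
  have inj: "inj_on f I"
  proof (rule inj_onI, rule ccontr)
    fix i j assume ij: "i \<in> I" "j \<in> I" "f i = f j" "i \<noteq> j"
    \<comment> \<open>Two indices with the same vector would give a nontrivial relation with
      coefficients \<open>1\<close> and \<open>-1\<close>.\<close>
    define d where "d l = (if l = i then 1 else if l = j then -1 else 0 :: complex)" for l
    have "(\<Sum>l\<in>I. poly_scale (d l) (f l)) = (\<Sum>l\<in>{i, j}. poly_scale (d l) (f l))"
      using I ij by (intro sum.mono_neutral_right) (auto simp: d_def)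
    also have "\<dots> = 0" using ij by (simp add: d_def)
    finally have "d i = 0" using indep ij by blast
    then show False by (simp add: d_def)
  qed
  moreover have "cpoly.independent (f ` I)"
  proof (rule cpoly.independent_if_scalars_zero)
    show "c p = 0" if "(\<Sum>q\<in>f ` I. poly_scale (c q) q) = 0" "p \<in> f ` I" for c p
      using that indep[of "\<lambda>i. c (f i)"] by (auto simp: sum.reindex[OF inj])
  qed (use I in simp)
  moreover have "cpoly.span (f ` I) = W"
  proof
    show "cpoly.span (f ` I) \<subseteq> W" using W by (intro cpoly.span_minimal) auto
    show "W \<subseteq> cpoly.span (f ` I)"
    proof
      fix p assume "p \<in> W"
      with span obtain d where "p = (\<Sum>j\<in>I. poly_scale (d j) (f j))" by blast
      then show "p \<in> cpoly.span (f ` I)"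
        by (auto intro: cpoly.span_sum cpoly.span_scale cpoly.span_base)
    qed
  qed
  ultimately show ?thesis by (simp add: basis_family_def)
qed


subsection \<open>Bases of quadrics\<close>

context even_theta_parity
begin

definition M :: "int \<Rightarrow> cpoly" where
  "M j = coord N (j + \<epsilon>) * coord N (- j)"

definition m :: "int \<Rightarrow> int \<Rightarrow>\<^sub>0 nat" where
  "m j = quad_monomial N (j + \<epsilon>) (- j)"

lemma M_eq_single: "M j = Poly_Mapping.single (m j) 1"
  by (simp add: M_def m_def coord_mult)

lemma M_cong: "i mod N = j mod N \<Longrightarrow> M i = M j"
  unfolding M_def by (intro arg_cong2[where f = "(*)"] coord_cong) (auto intro: mod_add_cong mod_minus_cong)

lemma M_reflect: "M (- \<epsilon> - j) = M j"
  by (simp add: M_def mult.commute)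

lemma inj_on_m: "inj_on m {0..h - \<epsilon>}"
proof (rule inj_onI)
  fix i j assume ij: "i \<in> {0..h - \<epsilon>}" "j \<in> {0..h - \<epsilon>}" and "m i = m j"
  then have "{(i + \<epsilon>) mod N, - i mod N} = {(j + \<epsilon>) mod N, - j mod N}"
    by (metis m_def keys_quad_monomial)
  then consider "(i + \<epsilon>) mod N = (j + \<epsilon>) mod N" | "(i + \<epsilon>) mod N = - j mod N"
    by (auto simp: doubleton_eq_iff)
  then show "i = j"
  proof cases
    case 1
    then have "N dvd i - j" by (simp add: mod_eq_dvd_iff)
    moreover have "\<bar>i - j\<bar> < N" using ij \<epsilon> N_eq h_ge by auto
    ultimately show ?thesis using zdvd_not_zless[of "\<bar>i - j\<bar>" N] by auto
  next
    case 2
    \<comment> \<open>This multiple of \<open>N\<close> lies in \<open>{0..N}\<close>. For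
      \<open>\<epsilon> = 0\<close> either end forces \<open>i = j\<close>; for
      \<open>\<epsilon> = 1\<close> neither is attained.\<close>
    then have "N dvd i + j + \<epsilon>" by (simp add: mod_eq_dvd_iff algebra_simps)
    then obtain q where q: "i + j + \<epsilon> = N * q" by blast
    have "0 \<le> N * q" "N * q \<le> N" using ij \<epsilon> N_eq unfolding q[symmetric] by auto
    then have "0 \<le> q" "q \<le> 1"
      using N_pos by (auto simp: zero_le_mult_iff mult_le_cancel_left1)
    then have "q = 0 \<or> q = 1" by auto
    with q ij \<epsilon> N_eq show ?thesis by auto
  qed
qed

lemma lookup_M:
  "i \<in> {0..h - \<epsilon>} \<Longrightarrow> j \<in> {0..h - \<epsilon>} \<Longrightarrow> Poly_Mapping.lookup (M j) (m i) = (if j = i then 1 else 0)"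
  using inj_on_m by (auto simp: M_eq_single lookup_single when_def dest: inj_onD)

lemma M_in_quad_span: "M j \<in> quad_span N \<epsilon>"
  unfolding M_def by (rule coord_mult_in_quad_span) simp

lemma ex_M:
  assumes "(i + j) mod N = \<epsilon> mod N"
  obtains l where "l \<in> {0..h - \<epsilon>}" "coord N i * coord N j = M l"
proof -
  define l where "l = (- j) mod N"
  have "(\<epsilon> - j) mod N = i mod N"
    using assms by (metis add_diff_cancel_right' mod_diff_left_eq)
  moreover have "- l mod N = j mod N" "(l + \<epsilon>) mod N = (\<epsilon> - j) mod N"
    unfolding l_def by (simp_all add: mod_simps add.commute)
  ultimately have eq: "coord N i * coord N j = M l"
    unfolding M_def by (metis coord_cong)
  show thesis
  proof (cases "l \<le> h - \<epsilon>")
    case True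
    then show ?thesis using that[of l] eq N_pos by (simp add: l_def)
  next
    case False
    \<comment> \<open>Exchanging the two factors replaces \<open>l\<close> by
      \<open>- \<epsilon> - l\<close>, which modulo \<open>N\<close> falls into the lower
      half.\<close>
    have "l < N" using N_pos by (simp add: l_def)
    moreover have "M (N - \<epsilon> - l) = M l"
      unfolding M_reflect[of l, symmetric] by (rule M_cong) (simp add: mod_diff_left_eq[symmetric, of N] algebra_simps)
    ultimately show ?thesis
      using that[of "N - \<epsilon> - l"] eq False \<epsilon> N_eq by auto
  qed
qed

text \<open>The monomials \<open>M j\<close> with \<open>j \<in> {0..h - \<epsilon>}\<close> are
  distinct and exhaust the generators, so coefficients at \<open>m j\<close> are
  coordinates.\<close>

lemma quad_span_expand:
  assumes "p \<in> quad_span N \<epsilon>"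
  shows "p = (\<Sum>j\<in>{0..h - \<epsilon>}. poly_scale (Poly_Mapping.lookup p (m j)) (M j))"
  using assms
proof (induction rule: quad_span_induct)
  case zero
  show ?case by simp
next
  case (add p q)
  then show ?case by (simp add: lookup_add cpoly.scale_left_distrib sum.distrib)
next
  case (scale c p)
  have "poly_scale c p =
      poly_scale c (\<Sum>j\<in>{0..h - \<epsilon>}. poly_scale (Poly_Mapping.lookup p (m j)) (M j))"
    by (rule arg_cong[OF scale])
  also have "\<dots> = (\<Sum>j\<in>{0..h - \<epsilon>}. poly_scale (Poly_Mapping.lookup (poly_scale c p) (m j)) (M j))"
    by (simp add: cpoly.scale_sum_right)
  finally show ?case .
next
  case (base i j)
  then obtain l where l: "l \<in> {0..h - \<epsilon>}" and eq: "coord N i * coord N j = M l"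
    by (rule ex_M)
  have "(\<Sum>j\<in>{0..h - \<epsilon>}. poly_scale (Poly_Mapping.lookup (M l) (m j)) (M j)) =
      (\<Sum>j\<in>{0..h - \<epsilon>}. if j = l then M j else 0)"
    using l by (intro sum.cong refl) (auto simp: lookup_M)
  with l show ?case by (simp add: eq)
qed

lemma eval_M: "eval_poly (M j) (theta_vec N \<tau> z) = F j z"
  by (simp add: M_def F_def eval_coord_mult_theta N_pos)

text \<open>After reduction of indices modulo \<open>N\<close> these are the two families of the
  theorem, for \<open>\<epsilon> = 0\<close> and \<open>\<epsilon> = 1\<close>.\<close>

definition Q :: "int \<Rightarrow> cpoly" where
  "Q j = poly_scale (a2 j) (M 0) + poly_scale (a2 (h + j)) (M (h - \<epsilon>))
     - poly_scale (a2 0) (M j) - poly_scale (a2 h) (M (h - \<epsilon> - j))"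

lemma Q_in_graded_quadrics: "Q j \<in> graded_quadrics N \<tau> \<epsilon>"
  using F_relation[of j]
  by (auto simp: graded_quadrics_iff N_pos Q_def eval_poly_add eval_poly_diff eval_poly_scale eval_M
      intro!: cpoly.subspace_add[OF subspace_quad_span] cpoly.subspace_diff[OF subspace_quad_span]
        cpoly.subspace_scale[OF subspace_quad_span] M_in_quad_span)

text \<open>At interior indices \<open>M 0\<close> and \<open>M (h - \<epsilon>)\<close> do not
  contribute. If \<open>i = h - \<epsilon> - i\<close>, both remaining contributions fall on the
  same \<open>d i\<close> and add up.\<close>

lemma lookup_sum_Q:
  assumes i: "i \<in> {1..h - \<epsilon> - 1}"
  shows "Poly_Mapping.lookup (\<Sum>j\<in>{1..h - \<epsilon> - 1}. poly_scale (d j) (Q j)) (m i) =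
    - a2 0 * d i - a2 h * d (h - \<epsilon> - i)"
proof -
  let ?I = "{1..h - \<epsilon> - 1}"
  have *: "Poly_Mapping.lookup (Q j) (m i) =
      - a2 0 * (if j = i then 1 else 0) - a2 h * (if j = h - \<epsilon> - i then 1 else 0)" if "j \<in> ?I" for j
    using i that h_ge \<epsilon> by (auto simp: Q_def lookup_add lookup_minus lookup_M)
  have "Poly_Mapping.lookup (\<Sum>j\<in>?I. poly_scale (d j) (Q j)) (m i) =
      (\<Sum>j\<in>?I. (if j = i then - a2 0 * d j else 0) + (if j = h - \<epsilon> - i then - a2 h * d j else 0))"
    unfolding lookup_sum
  proof (rule sum.cong[OF refl])
    fix j assume "j \<in> ?I"
    then have "Poly_Mapping.lookup (poly_scale (d j) (Q j)) (m i) = d j *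
        (- a2 0 * (if j = i then 1 else 0) - a2 h * (if j = h - \<epsilon> - i then 1 else 0))"
      by (simp only: lookup_poly_scale *)
    also have "\<dots> = (if j = i then - a2 0 * d j else 0) + (if j = h - \<epsilon> - i then - a2 h * d j else 0)"
      by (simp add: algebra_simps)
    finally show "Poly_Mapping.lookup (poly_scale (d j) (Q j)) (m i) = \<dots>" .
  qed
  also have "\<dots> = - a2 0 * d i - a2 h * d (h - \<epsilon> - i)"
    using i by (simp add: sum.distrib)
  finally show ?thesis .
qed

text \<open>
  On the coefficients of the monomials \<open>M j\<close> and \<open>M (h - \<epsilon> - j)\<close> the passage from the scalars \<open>d\<close> to
  \<open>\<Sum>j. d j Q j\<close> is a \<open>2 \<times> 2\<close> system of determinant \<open>(a2 0)\<^sup>2 - (a2 h)\<^sup>2 \<noteq> 0\<close>.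
\<close>

lemma basis_family_Q: "basis_family Q {1..h - \<epsilon> - 1} (graded_quadrics N \<tau> \<epsilon>)"
proof (rule basis_familyI)
  let ?I = "{1..h - \<epsilon> - 1}"
  let ?D = "(a2 0)\<^sup>2 - (a2 h)\<^sup>2"
  have D: "?D \<noteq> 0" using a2_sq_neq by simp
  have reflect: "h - \<epsilon> - i \<in> ?I" "h - \<epsilon> - (h - \<epsilon> - i) = i" if "i \<in> ?I" for i using that by auto
  show "d i = 0" if zero: "(\<Sum>j\<in>?I. poly_scale (d j) (Q j)) = 0" and i: "i \<in> ?I" for d i
  proof -
    have eqs: "- a2 0 * d i - a2 h * d (h - \<epsilon> - i) = 0" "- a2 0 * d (h - \<epsilon> - i) - a2 h * d i = 0"
      using lookup_sum_Q[OF i, of d] lookup_sum_Q[OF reflect(1)[OF i], of d] reflect(2)[OF i]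
      unfolding zero by simp_all
    have "?D * d i = a2 h * (- a2 0 * d (h - \<epsilon> - i) - a2 h * d i) - a2 0 * (- a2 0 * d i - a2 h * d (h - \<epsilon> - i))"
      by (simp add: power2_eq_square algebra_simps)
    with D show ?thesis unfolding eqs by simp
  qed
  show "\<exists>d. p = (\<Sum>j\<in>?I. poly_scale (d j) (Q j))" if p: "p \<in> graded_quadrics N \<tau> \<epsilon>" for p
  proof -
    define c where "c j = Poly_Mapping.lookup p (m j)" for j
    \<comment> \<open>Cramer's rule: this choice cancels all interior coefficients of the remainder
      \<open>q\<close>.\<close>
    define d where "d j = (a2 h * c (h - \<epsilon> - j) - a2 0 * c j) / ?D" for j
    define q where "q = p - (\<Sum>j\<in>?I. poly_scale (d j) (Q j))"
    note sub = subspace_graded_quadrics[OF N_pos]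
    have q: "q \<in> graded_quadrics N \<tau> \<epsilon>"
      unfolding q_def
      by (intro cpoly.subspace_diff[OF sub p] cpoly.subspace_sum[OF sub] cpoly.subspace_scale[OF sub]
          Q_in_graded_quadrics)
    have zero: "Poly_Mapping.lookup q (m i) = 0" if i: "i \<in> ?I" for i
    proof -
      have "?D * d j = a2 h * c (h - \<epsilon> - j) - a2 0 * c j" for j
        using D by (simp add: d_def)
      then have "?D * (a2 0 * d i + a2 h * d (h - \<epsilon> - i)) =
          a2 0 * (a2 h * c (h - \<epsilon> - i) - a2 0 * c i) + a2 h * (a2 h * c i - a2 0 * c (h - \<epsilon> - i))"
        by (simp only: distrib_left mult.left_commute[of ?D] reflect(2)[OF i])
      also have "\<dots> = - (?D * c i)" by (simp add: power2_eq_square algebra_simps)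
      finally have "?D * (a2 0 * d i + a2 h * d (h - \<epsilon> - i) + c i) = 0" by (simp add: algebra_simps)
      with D have "a2 0 * d i + a2 h * d (h - \<epsilon> - i) + c i = 0" by (metis mult_eq_0_iff)
      then have "c i - (- a2 0 * d i - a2 h * d (h - \<epsilon> - i)) = 0" by (simp add: algebra_simps)
      then show ?thesis
        unfolding q_def lookup_minus lookup_sum_Q[OF i] c_def .
    qed
    define u v where "u = Poly_Mapping.lookup q (m 0)" and "v = Poly_Mapping.lookup q (m (h - \<epsilon>))"
    have "{0..h - \<epsilon>} = insert 0 (insert (h - \<epsilon>) ?I)" using \<epsilon> h_ge by auto
    moreover have "h - \<epsilon> \<noteq> 0" using \<epsilon> h_ge by auto
    moreover have "q \<in> quad_span N \<epsilon>" using q by (simp add: graded_quadrics_iff N_pos)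
    ultimately have q_eq: "q = poly_scale u (M 0) + poly_scale v (M (h - \<epsilon>))"
      using quad_span_expand[of q] zero by (simp add: u_def v_def)
    \<comment> \<open>Only the two extreme monomials survive in \<open>q\<close>, and their
      restrictions to the curve are independent.\<close>
    have "u * F 0 z + v * F (h - \<epsilon>) z = 0" for z
    proof -
      have "eval_poly q (theta_vec N \<tau> z) = 0" using q by (simp add: graded_quadrics_iff N_pos)
      then show ?thesis unfolding q_eq by (simp add: eval_poly_add eval_poly_scale eval_M)
    qed
    then have "u = 0" "v = 0" using F_independent by blast+
    then have "q = 0" by (simp add: q_eq)
    then show ?thesis by (auto simp: q_def)
  qed
qed (simp_all add: subspace_graded_quadrics N_pos Q_in_graded_quadrics)

end

theorem theorem6p8:
  fixes N :: int and \<tau> :: complex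
    and a :: "int \<Rightarrow> complex" and X :: "int \<Rightarrow> cpoly" and V :: "int \<Rightarrow> cpoly set"
  assumes N: "N \<ge> 4" "even N" and tau: "Im \<tau> > 0"
  defines "a \<equiv> \<lambda>i. theta N i 0 \<tau>"
    and "X \<equiv> coord N"
    and "V \<equiv> graded_quadrics N \<tau>"
  shows "(\<forall>k\<in>{0..N div 2 - 1}. \<exists>\<phi>.
           Vector_Spaces.linear poly_scale poly_scale \<phi> \<and>
           (\<forall>i j. \<phi> (X i * X j) = X (i + k) * X (j + k)) \<and>
           bij_betw \<phi> (V 0) (V (2 * k)) \<and>
           bij_betw \<phi> (V 1) (V (2 * k + 1))) \<and>
         basis_family
           (\<lambda>j. poly_scale ((a j)\<^sup>2) ((X 0)\<^sup>2)
              + poly_scale ((a (N div 2 + j))\<^sup>2) ((X (N div 2))\<^sup>2)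
              - poly_scale ((a 0)\<^sup>2) (X j * X (N - j))
              - poly_scale ((a (N div 2))\<^sup>2) (X (N div 2 + j) * X (N div 2 - j)))
           {1..N div 2 - 1} (V 0) \<and>
         basis_family
           (\<lambda>j. poly_scale (a j * a (j + 1)) (X 0 * X 1)
              + poly_scale (a (N div 2 + j) * a (N div 2 + j + 1)) (X (N div 2) * X (N div 2 + 1))
              - poly_scale (a 0 * a 1) (X (j + 1) * X (N - j))
              - poly_scale (a (N div 2) * a (N div 2 + 1)) (X (N div 2 + j + 1) * X (N div 2 - j)))
           {1..N div 2 - 2} (V 1)"
proof -
  define h where "h = N div 2"
  have N_eq: "N = 2 * h" and h: "h \<ge> 2" using N by (auto simp: h_def)
  have N_pos: "N > 0" using N by simp
  have X_N: "X (N - j) = X (- j)" for j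
    unfolding X_def by (rule coord_cong) simp
  \<comment> \<open>Brings the index \<open>- (h - j)\<close> occurring in \<open>M (h - j)\<close>
    to the form used in the statement.\<close>
  have X_h: "X (j - h) = X (h + j)" for j
    unfolding X_def by (rule coord_cong) (simp add: N_eq mod_eq_dvd_iff)
  have "\<exists>\<phi>. Vector_Spaces.linear poly_scale poly_scale \<phi> \<and>
      (\<forall>i j. \<phi> (X i * X j) = X (i + k) * X (j + k)) \<and>
      bij_betw \<phi> (V 0) (V (2 * k)) \<and> bij_betw \<phi> (V 1) (V (2 * k + 1))" for k
    using linear_rotate_poly[OF N_pos, of k] rotate_poly_coord_mult[OF N_pos, of k]
      bij_betw_rotate_poly[OF N_pos, of k \<tau> 0] bij_betw_rotate_poly[OF N_pos, of k \<tau> 1]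
    unfolding X_def V_def add_0_left add.commute[of 1] by blast
  moreover have "basis_family
      (\<lambda>j. poly_scale ((a j)\<^sup>2) ((X 0)\<^sup>2)
         + poly_scale ((a (h + j))\<^sup>2) ((X h)\<^sup>2)
         - poly_scale ((a 0)\<^sup>2) (X j * X (N - j))
         - poly_scale ((a h)\<^sup>2) (X (h + j) * X (h - j)))
      {1..h - 1} (V 0)" (is "basis_family ?Q _ _")
  proof -
    interpret even_theta_parity N h \<tau> 0
      using N_eq h tau by unfold_locales auto
    have "X (- h) = X h" using X_h[of 0] by simp
    then have "M 0 = (X 0)\<^sup>2" "M (h - 0) = (X h)\<^sup>2"
      by (simp_all add: M_def X_def power2_eq_square)
    moreover have "M j = X j * X (N - j)" "M (h - 0 - j) = X (h + j) * X (h - j)" for j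
      using X_N[of j] X_h[of j] by (simp_all add: M_def X_def mult.commute)
    moreover have "a2 j = (a j)\<^sup>2" for j
      by (simp add: a2_def a_def power2_eq_square)
    ultimately have "Q j = ?Q j" for j
      by (simp only: Q_def)
    then have "Q = ?Q" by (rule ext)
    with basis_family_Q show ?thesis by (simp only: V_def diff_zero)
  qed
  moreover have "basis_family
      (\<lambda>j. poly_scale (a j * a (j + 1)) (X 0 * X 1)
         + poly_scale (a (h + j) * a (h + j + 1)) (X h * X (h + 1))
         - poly_scale (a 0 * a 1) (X (j + 1) * X (N - j))
         - poly_scale (a h * a (h + 1)) (X (h + j + 1) * X (h - j)))
      {1..h - 2} (V 1)" (is "basis_family ?Q _ _")
  proof -
    interpret even_theta_parity N h \<tau> 1
      using N_eq h tau by unfold_locales auto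
    have "M 0 = X 0 * X 1" "M (h - 1) = X h * X (h + 1)"
      using X_h[of 1] by (simp_all add: M_def X_def mult.commute)
    moreover have "M j = X (j + 1) * X (N - j)" "M (h - 1 - j) = X (h + j + 1) * X (h - j)" for j
    proof -
      have "X (- (h - 1 - j)) = X (h + j + 1)"
        using X_h[of "j + 1"] by (simp add: algebra_simps)
      then show "M j = X (j + 1) * X (N - j)" "M (h - 1 - j) = X (h + j + 1) * X (h - j)"
        using X_N[of j] by (simp_all add: M_def X_def mult.commute)
    qed
    moreover have "a2 j = a j * a (j + 1)" for j
      by (simp add: a2_def a_def)
    ultimately have "Q j = ?Q j" for j
      by (simp only: Q_def add_0_left)
    then have "Q = ?Q" by (rule ext)
    \<comment> \<open>For \<open>N = 4\<close> this range is empty and the claim says that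
      \<open>V 1\<close> is zero.\<close>
    moreover have "h - 1 - 1 = h - 2" by simp
    ultimately show ?thesis using basis_family_Q by (simp only: V_def)
  qed
  ultimately show ?thesis unfolding h_def by blast
qed

end
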